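(* Let $P$ be a Schröder path and let $(x,z)\in\mathbb{Z}^2$ be a point on $P$ with $z>x+1$ such that the bounce path of $P$ at $(x,z)$ has exactly one bounce point and the bounce decomposition of $P$ at $(x,z)$ is $P=U\mathtt{d}\cdot\mathtt{n}V\mathtt{d}\cdot\mathtt{e}W$. Then $\mathrm{G}_P(\mathbf{x};q)=\mathrm{G}_{U\mathtt{n}\mathtt{d}V\mathtt{e}\mathtt{d}W}(\mathbf{x};q)$.
   Context: Steps: $\mathtt{n}=(0,1)$, $\mathtt{e}=(1,0)$, $\mathtt{d}=(1,1)$. A Schröder path of size $n$ is a lattice path from $(0,0)$ to $(n,n)$ with steps in $\{\mathtt{n},\mathtt{e},\mathtt{d}\}$ such that every east and every diagonal step is preceded by strictly more north steps than east steps; paths are words in $\{\mathtt{n},\mathtt{d},\mathtt{e}\}^*$. Bounce path of $P$ (size $n$) at a lattice point $(u_1,u_0)$ on $P$: move south from $(u_1,u_0)$ to $(u_1,u_1)$, then west until first reaching a point $(u_2,u_1)$ of $P$; if that point lies between two diagonal steps of $P$, continue south to $(u_2,u_2)$ and west to a point $(u_3,u_2)$ of $P$, and so on, stopping at the first point $(u_{k+1},u_k)$ incident to a north or east step of $P$. The points $(u_i,u_i)$ are the bounce points. The bounce decomposition at $(u_1,u_0)$ is the unique factorisation $P=Us_1\cdot s_2Vs_3\cdot s_4W$ ($s_i$ single steps) where $Us_1$ is the part of $P$ from $(0,0)$ to $(u_{k+1},u_k)$ and $s_4W$ is the part from $(u_1,u_0)$ to $(n,n)$; dots are only markers. $\Gamma_P$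 is the graph on $[n]$ where, for $1\le a<b\le n$, $\{a,b\}$ is a non-strict edge if the unit square $[a-1,a]\times[b-1,b]$ lies in the region between $P$ and the line $y=x$, and a strict edge if $P$ has a diagonal step from $(a-1,b-1)$ to $(a,b)$. A coloring is a map $\kappa:[n]\to\mathbb{Z}_{>0}$ with $\kappa(a)<\kappa(b)$ for each strict edge $\{a,b\}$, $a<b$; $\mathrm{asc}(\kappa)$ is the number of non-strict edges $\{a,b\}$, $a<b$, with $\kappa(a)<\kappa(b)$. $\mathrm{G}_P(\mathbf{x};q)=\sum_\kappa q^{\mathrm{asc}(\kappa)}x_{\kappa(1)}\cdots x_{\kappa(n)}$ over all colorings. *)

theory Defs
  imports "HOL-Analysis.Analysis" "HOL-Library.Multiset" "HOL-Library.FuncSet"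
    "HOL-Computational_Algebra.Polynomial"
begin

section \<open>Schroeder paths\<close>

datatype step = North | East | Diag

fun step_vec :: "step \<Rightarrow> int \<times> int" where
  "step_vec North = (0, 1)"
| "step_vec East = (1, 0)"
| "step_vec Diag = (1, 1)"

definition endpoint :: "step list \<Rightarrow> int \<times> int" where
  "endpoint w = sum_list (map step_vec w)"

definition schroeder_path :: "nat \<Rightarrow> step list \<Rightarrow> bool" where
  "schroeder_path n P \<longleftrightarrow> endpoint P = (int n, int n) \<and>
     (\<forall>A s B. P = A @ s # B \<and> s \<noteq> North \<longrightarrow> count_list A North > count_list A East)"

text \<open>A step has no lattice points other than its two ends, so the lattice points lying on a path
  are exactly the end points of its prefixes.\<close>
definition lattice_points :: "step list \<Rightarrow> (int \<times> int) set" where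
  "lattice_points P = {endpoint A | A B. P = A @ B}"


section \<open>Bounce paths and the bounce decomposition\<close>

definition incident_north_or_east :: "step list \<Rightarrow> int \<times> int \<Rightarrow> bool" where
  "incident_north_or_east P p \<longleftrightarrow>
     (\<exists>A s B. P = A @ s # B \<and> s \<in> {North, East} \<and> (p = endpoint A \<or> p = endpoint (A @ [s])))"

definition between_diagonals :: "step list \<Rightarrow> int \<times> int \<Rightarrow> bool" where
  "between_diagonals P p \<longleftrightarrow> (\<exists>A B. P = A @ [Diag, Diag] @ B \<and> p = endpoint (A @ [Diag]))"

text \<open>\<open>(v, u)\<close> is the first point of \<open>P\<close> met on the ray going west from \<open>(u, u)\<close>. If \<open>(u, u)\<close> lies
  on \<open>P\<close> already, then \<open>v = u\<close>.\<close>
definition first_west :: "step list \<Rightarrow> int \<Rightarrow> int \<Rightarrow> bool" where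
  "first_west P u v \<longleftrightarrow> v \<le> u \<and> (v, u) \<in> lattice_points P \<and>
     (\<forall>w. v < w \<and> w \<le> u \<longrightarrow> (w, u) \<notin> lattice_points P)"

text \<open>\<open>bounce_path P (u\<^sub>1, u\<^sub>0) bs p\<close>: the bounce path of \<open>P\<close> at \<open>(u\<^sub>1, u\<^sub>0)\<close> has the bounce
  points \<open>bs = [(u\<^sub>1, u\<^sub>1), \<dots>, (u\<^sub>k, u\<^sub>k)]\<close> and stops at \<open>p = (u\<^bsub>k+1\<^esub>, u\<^sub>k)\<close>.\<close>
inductive bounce_path ::
  "step list \<Rightarrow> int \<times> int \<Rightarrow> (int \<times> int) list \<Rightarrow> int \<times> int \<Rightarrow> bool" for P where
  stop: "\<lbrakk>(u1, u0) \<in> lattice_points P; first_west P u1 u2; incident_north_or_east P (u2, u1)\<rbrakk>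
    \<Longrightarrow> bounce_path P (u1, u0) [(u1, u1)] (u2, u1)"
| bounce: "\<lbrakk>(u1, u0) \<in> lattice_points P; first_west P u1 u2; between_diagonals P (u2, u1);
      bounce_path P (u2, u1) bs p\<rbrakk>
    \<Longrightarrow> bounce_path P (u1, u0) ((u1, u1) # bs) p"

text \<open>The bounce decomposition of \<open>P\<close> at \<open>r\<close> is \<open>P = U s\<^sub>1 \<cdot> s\<^sub>2 V s\<^sub>3 \<cdot> s\<^sub>4 W\<close>. The two
  dots sit at the point where the bounce path stops and at \<open>r\<close>.\<close>
definition bounce_decomposition ::
  "step list \<Rightarrow> int \<times> int \<Rightarrow> step list \<Rightarrow> step \<Rightarrow> step \<Rightarrow> step list \<Rightarrow> step \<Rightarrow> step \<Rightarrow> step list \<Rightarrow> bool"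
where
  "bounce_decomposition P r U s1 s2 V s3 s4 W \<longleftrightarrow>
     P = U @ [s1] @ [s2] @ V @ [s3] @ [s4] @ W \<and>
     (\<exists>bs. bounce_path P r bs (endpoint (U @ [s1]))) \<and>
     endpoint (U @ [s1] @ [s2] @ V @ [s3]) = r"


section \<open>The graph of a path and its colorings\<close>

definition real_point :: "int \<times> int \<Rightarrow> real \<times> real" where
  "real_point p = (real_of_int (fst p), real_of_int (snd p))"

definition path_curve :: "step list \<Rightarrow> (real \<times> real) set" where
  "path_curve P = \<Union> {closed_segment (real_point (endpoint A)) (real_point (endpoint (A @ [s])))
     | A s B. P = A @ s # B}"

text \<open>The closed region between \<open>P\<close> and the line \<open>y = x\<close>: the points weakly above the line and
  weakly below some point of \<open>P\<close>.\<close>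
definition region :: "step list \<Rightarrow> (real \<times> real) set" where
  "region P = {(s, t). s \<le> t \<and> (\<exists>t'\<ge>t. (s, t') \<in> path_curve P)}"

text \<open>In both edge predicates the pair \<open>(a, b)\<close> with \<open>a < b\<close> stands for the edge \<open>{a, b}\<close>.\<close>
definition nonstrict_edge :: "nat \<Rightarrow> step list \<Rightarrow> nat \<Rightarrow> nat \<Rightarrow> bool" where
  "nonstrict_edge n P a b \<longleftrightarrow> 1 \<le> a \<and> a < b \<and> b \<le> n \<and>
     {real a - 1 .. real a} \<times> {real b - 1 .. real b} \<subseteq> region P"

definition strict_edge :: "nat \<Rightarrow> step list \<Rightarrow> nat \<Rightarrow> nat \<Rightarrow> bool" where
  "strict_edge n P a b \<longleftrightarrow> 1 \<le> a \<and> a < b \<and> b \<le> n \<and>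
     (\<exists>A B. P = A @ Diag # B \<and> endpoint A = (int a - 1, int b - 1) \<and>
        endpoint (A @ [Diag]) = (int a, int b))"

definition colorings :: "nat \<Rightarrow> step list \<Rightarrow> (nat \<Rightarrow> nat) set" where
  "colorings n P = {\<kappa> \<in> {1..n} \<rightarrow>\<^sub>E {1..}. \<forall>a b. strict_edge n P a b \<longrightarrow> \<kappa> a < \<kappa> b}"

definition asc :: "nat \<Rightarrow> step list \<Rightarrow> (nat \<Rightarrow> nat) \<Rightarrow> nat" where
  "asc n P \<kappa> = card {(a, b). nonstrict_edge n P a b \<and> \<kappa> a < \<kappa> b}"

text \<open>The multiset \<open>{#i\<^sub>1, \<dots>, i\<^sub>n#}\<close> stands for the monomial \<open>x\<^bsub>i\<^sub>1\<^esub> \<cdots> x\<^bsub>i\<^sub>n\<^esub>\<close>.\<close>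
definition color_monomial :: "nat \<Rightarrow> (nat \<Rightarrow> nat) \<Rightarrow> nat multiset" where
  "color_monomial n \<kappa> = image_mset \<kappa> (mset_set {1..n})"

text \<open>A formal power series in \<open>x\<^sub>1, x\<^sub>2, \<dots>\<close> over \<open>\<int>[q]\<close> is given by its coefficients, as a
  function from monomials to polynomials in \<open>q\<close>. Each coefficient of \<open>G n P\<close> is a finite sum by
  \<open>finite_colorings_monomial\<close>.\<close>
definition G :: "nat \<Rightarrow> step list \<Rightarrow> nat multiset \<Rightarrow> int poly" where
  "G n P = (\<lambda>m. \<Sum>\<kappa> | \<kappa> \<in> colorings n P \<and> color_monomial n \<kappa> = m. monom 1 (asc n P \<kappa>))"


section \<open>Well-definedness\<close>

lemma finite_colorings_monomial: "finite {\<kappa> \<in> colorings n P. color_monomial n \<kappa> = m}"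
proof (rule finite_subset)
  show "{\<kappa> \<in> colorings n P. color_monomial n \<kappa> = m} \<subseteq> {1..n} \<rightarrow>\<^sub>E set_mset m"
    by (auto simp: colorings_def color_monomial_def PiE_iff extensional_def)
  show "finite ({1..n} \<rightarrow>\<^sub>E set_mset m)"
    by (intro finite_PiE) auto
qed

lemma finite_ascents: "finite {(a, b). nonstrict_edge n P a b \<and> \<kappa> a < \<kappa> b}"
  by (rule finite_subset[of _ "{1..n} \<times> {1..n}"]) (auto simp: nonstrict_edge_def)

lemma endpoint_append: "endpoint (A @ B) = endpoint A + endpoint B"
  by (simp add: endpoint_def)

lemma schroeder_path_bounce_swap:
  assumes P: "schroeder_path n (U @ [Diag, North] @ V @ [Diag, East] @ W)"
    and r: "endpoint (U @ [Diag, North] @ V @ [Diag]) = (x, z)" and xz: "z > x + 1"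
  shows "schroeder_path n (U @ [North, Diag] @ V @ [East, Diag] @ W)"
proof -
  define ok where "ok = (\<lambda>h P. \<forall>A s B. P = A @ s # B \<and> s \<noteq> North \<longrightarrow>
    h + int (count_list A North) - int (count_list A East) > 0)"
  have ok_Nil: "ok h []" for h by (simp add: ok_def)
  have ok_Cons: "ok h (t # Q) \<longleftrightarrow> (t \<noteq> North \<longrightarrow> h > 0) \<and>
      ok (h + snd (step_vec t) - fst (step_vec t)) Q" for h t Q
  proof
    assume L: "ok h (t # Q)"
    have "h > 0" if "t \<noteq> North"
      using L[unfolded ok_def, rule_format, of "[]" t Q] that by simp
    moreover have "ok (h + snd (step_vec t) - fst (step_vec t)) Q"
      unfolding ok_def
    proof (intro allI impI, elim conjE)
      fix A s B assume "Q = A @ s # B" "s \<noteq> North"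
      then have "h + int (count_list (t # A) North) - int (count_list (t # A) East) > 0"
        using L[unfolded ok_def, rule_format, of "t # A" s B] by simp
      then show "h + snd (step_vec t) - fst (step_vec t) + int (count_list A North)
          - int (count_list A East) > 0"
        by (cases t) auto
    qed
    ultimately show "(t \<noteq> North \<longrightarrow> h > 0) \<and> ok (h + snd (step_vec t) - fst (step_vec t)) Q"
      by blast
  next
    assume R: "(t \<noteq> North \<longrightarrow> h > 0) \<and> ok (h + snd (step_vec t) - fst (step_vec t)) Q"
    show "ok h (t # Q)"
      unfolding ok_def
    proof (intro allI impI, elim conjE)
      fix A s B assume eq: "t # Q = A @ s # B" and s: "s \<noteq> North"
      show "h + int (count_list A North) - int (count_list A East) > 0"
      proof (cases A)
        case Nil
        then show ?thesis using R eq s by simp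
      next
        case (Cons t' A')
        then have "h + snd (step_vec t) - fst (step_vec t) + int (count_list A' North)
            - int (count_list A' East) > 0"
          using R eq s unfolding ok_def by simp
        then show ?thesis using Cons eq by (cases t) auto
      qed
    qed
  qed
  have ok_append: "ok h (Q @ R) \<longleftrightarrow>
      ok h Q \<and> ok (h + snd (endpoint Q) - fst (endpoint Q)) R" for h Q R
    by (induction Q arbitrary: h) (auto simp: ok_Nil ok_Cons endpoint_def algebra_simps)
  have sp: "schroeder_path n Q \<longleftrightarrow> endpoint Q = (int n, int n) \<and> ok 0 Q" for Q
    by (auto simp: schroeder_path_def ok_def)
  have e: "endpoint [] = (0, 0)" "endpoint (t # Q) = step_vec t + endpoint Q" for t Q
    by (auto simp: endpoint_def zero_prod_def)
  show ?thesis
    using P r xz unfolding sp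
    by (cases "endpoint U"; cases "endpoint V"; cases "endpoint W")
      (auto simp: ok_append ok_Cons ok_Nil endpoint_append e algebra_simps)
qed

end

theory Submission
  imports Defs
begin

text \<open>
  Let \<open>y\<close> be the abscissa of the point where the bounce path stops. On the vertices other than
  \<open>y\<close>, \<open>z\<close> the vertices \<open>x\<close> and \<open>x + 1\<close> have the same, non-strict, neighbours in both graphs, and
  they are joined by a non-strict edge. The two graphs differ only in the edges towards \<open>y\<close> and \<open>z\<close>:
  before the move there are strict edges \<open>y x\<close>, \<open>x z\<close> and a non-strict edge \<open>(x + 1) z\<close>, afterwards
  strict edges \<open>y (x + 1)\<close>, \<open>(x + 1) z\<close> and a non-strict edge \<open>y x\<close>. The bijection between colorings
  exchanges the colors of \<open>x\<close> and \<open>x + 1\<close> unless both lie strictly between those of \<open>y\<close> and \<open>z\<close>;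
  in either case the number of ascents is preserved.
\<close>

section \<open>Exchanging the colors of two vertices\<close>

text \<open>As a sum over edges, the ascent number gains exactly one summand for each edge inserted
  into the edge set.\<close>

lemma asc_eq_sum:
  "asc n P \<kappa> = (\<Sum>(a, b) | nonstrict_edge n P a b. of_bool (\<kappa> a < \<kappa> b))"
proof -
  have "finite {(a, b). nonstrict_edge n P a b}"
    by (rule finite_subset[of _ "{1..n} \<times> {1..n}"]) (auto simp: nonstrict_edge_def)
  then show ?thesis
    by (simp add: asc_def case_prod_unfold sum.If_cases of_bool_def Int_def conj_commute)
qed

lemma color_monomial_transpose:
  assumes "i \<in> {1..n}" "j \<in> {1..n}"
  shows "color_monomial n (\<kappa> \<circ> Transposition.transpose i j) = color_monomial n \<kappa>"
proof -
  have "image_mset (Transposition.transpose i j) (mset_set {1..n}) = mset_set {1..n}"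
    using assms transpose_image_eq[of i "{1..n}" j]
    by (simp add: image_mset_mset_set inj_on_transpose del: One_nat_def)
  then show ?thesis
    unfolding color_monomial_def by (metis multiset.map_comp)
qed

text \<open>The graph-theoretic core of the argument, free of paths: \<open>i\<close>,
  \<open>j\<close>, \<open>v\<close>, \<open>w\<close> stand for x, x + 1, y, z. \<open>E\<close>
  and \<open>S\<close> collect the edges that both graphs share, apart from the edge joining
  \<open>i\<close> and \<open>j\<close>. That edge is kept out of \<open>E\<close> because the
  transposition reverses it.\<close>

lemma G_eq_of_swapped_vertices:
  assumes nonstrict_P: "\<And>a b. nonstrict_edge n P a b \<longleftrightarrow> (a, b) \<in> E \<or> (a, b) = (i, j) \<or> (a, b) = (j, w)"
    and nonstrict_Q: "\<And>a b. nonstrict_edge n Q a b \<longleftrightarrow> (a, b) \<in> E \<or> (a, b) = (i, j) \<or> (a, b) = (v, i)"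
    and notin: "(i, j) \<notin> E" "(j, w) \<notin> E" "(v, i) \<notin> E"
    and inv: "\<And>a b. (a, b) \<in> E \<Longrightarrow> (Transposition.transpose i j a, Transposition.transpose i j b) \<in> E"
    and strict_P: "\<And>a b. strict_edge n P a b \<longleftrightarrow> (a, b) \<in> S \<or> (a, b) = (v, i) \<or> (a, b) = (i, w)"
    and strict_Q: "\<And>a b. strict_edge n Q a b \<longleftrightarrow> (a, b) \<in> S \<or> (a, b) = (v, j) \<or> (a, b) = (j, w)"
    and S: "\<And>a b. (a, b) \<in> S \<Longrightarrow> a \<notin> {i, j} \<and> b \<notin> {i, j}"
    and ij: "i \<in> {1..n}" "j \<in> {1..n}" and neq: "i \<noteq> j" "v \<notin> {i, j}" "w \<notin> {i, j}"
  shows "G n P = G n Q"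
proof
  fix m
  define \<tau> where "\<tau> = Transposition.transpose i j"
  have \<tau>: "\<tau> i = j" "\<tau> j = i" "\<tau> v = v" "\<tau> w = w" "\<And>k. k \<notin> {i, j} \<Longrightarrow> \<tau> k = k" "\<And>k. \<tau> (\<tau> k) = k"
    using neq by (auto simp: \<tau>_def)
  \<comment> \<open>This condition is symmetric in the colors of \<open>i\<close> and
    \<open>j\<close>, so swapping does not change which case applies and \<phi> is an
    involution.\<close>
  define between where "between \<kappa> \<longleftrightarrow> {\<kappa> i, \<kappa> j} \<subseteq> {\<kappa> v<..<\<kappa> w}" for \<kappa> :: "nat \<Rightarrow> nat"
  define \<phi> where "\<phi> \<kappa> = (if between \<kappa> then \<kappa> else \<kappa> \<circ> \<tau>)" for \<kappa>
  have \<phi>\<phi>: "\<phi> (\<phi> \<kappa>) = \<kappa>" for \<kappa>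
    by (auto simp: \<phi>_def between_def \<tau> fun_eq_iff)
  have edges_P: "1 \<le> a \<and> a < b \<and> b \<le> n" if "(a, b) \<in> E" for a b
    using nonstrict_P[of a b] that by (auto simp: nonstrict_edge_def)
  have finE: "finite E"
    by (rule finite_subset[of _ "{1..n} \<times> {1..n}"]) (use edges_P in \<open>force, simp\<close>)
  define N where "N \<kappa> = (\<Sum>(a, b)\<in>E. of_bool (\<kappa> a < \<kappa> b) :: nat)" for \<kappa> :: "nat \<Rightarrow> nat"
  have N_swap: "N (\<kappa> \<circ> \<tau>) = N \<kappa>" for \<kappa>
    unfolding N_def
    by (rule sum.reindex_bij_witness[where i = "map_prod \<tau> \<tau>" and j = "map_prod \<tau> \<tau>"])
      (auto simp: \<tau> inv[folded \<tau>_def])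
  have set_P: "{(a, b). nonstrict_edge n P a b} = insert (j, w) (insert (i, j) E)"
    using nonstrict_P by auto
  have set_Q: "{(a, b). nonstrict_edge n Q a b} = insert (v, i) (insert (i, j) E)"
    using nonstrict_Q by auto
  have asc_P: "asc n P \<kappa> = of_bool (\<kappa> j < \<kappa> w) + of_bool (\<kappa> i < \<kappa> j) + N \<kappa>" for \<kappa>
    unfolding asc_eq_sum set_P N_def using finE notin neq by simp
  have asc_Q: "asc n Q \<kappa> = of_bool (\<kappa> v < \<kappa> i) + of_bool (\<kappa> i < \<kappa> j) + N \<kappa>" for \<kappa>
    unfolding asc_eq_sum set_Q N_def using finE notin neq by simp
  \<comment> \<open>If the color of \<open>j\<close> also lies strictly between those of
    \<open>v\<close> and \<open>w\<close>, the edges (j, w) and (v, i) are both ascents and nothing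
    is swapped. If it is at most the color of \<open>v\<close>, the old ascent (j, w) is replaced by
    (i, j). If it is at least the color of \<open>w\<close>, the old ascent (i, j) is replaced by
    (v, i).\<close>
  have asc_\<phi>: "asc n Q (\<phi> \<kappa>) = asc n P \<kappa>" if "\<kappa> v < \<kappa> i" "\<kappa> i < \<kappa> w" for \<kappa>
    using that by (auto simp: asc_P asc_Q \<phi>_def between_def N_swap \<tau>)
  have PiE_\<phi>: "\<phi> \<kappa> \<in> {1..n} \<rightarrow>\<^sub>E {1..}" if "\<kappa> \<in> {1..n} \<rightarrow>\<^sub>E {1..}" for \<kappa>
  proof -
    have "\<tau> k \<in> {1..n} \<longleftrightarrow> k \<in> {1..n}" for k
      using \<tau>(1,2) \<tau>(5)[of k] ij by (cases "k \<in> {i, j}") auto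
    then show ?thesis
      using that by (auto simp: \<phi>_def PiE_iff extensional_def)
  qed
  \<comment> \<open>In a coloring for \<open>P\<close> the color of \<open>i\<close> lies between
    those of \<open>v\<close> and \<open>w\<close>. The color of \<open>j\<close> must do so for
    \<open>Q\<close>, which holds either already or after the swap.\<close>
  have P_to_Q: "\<phi> \<kappa> \<in> colorings n Q" if "\<kappa> \<in> colorings n P" for \<kappa>
  proof -
    have \<kappa>: "\<kappa> v < \<kappa> i" "\<kappa> i < \<kappa> w" "\<And>a b. (a, b) \<in> S \<Longrightarrow> \<kappa> a < \<kappa> b"
      using that strict_P by (auto simp: colorings_def)
    have "\<phi> \<kappa> a < \<phi> \<kappa> b" if "strict_edge n Q a b" for a b
      using that \<kappa> S[of a b] \<tau> unfolding strict_Q \<phi>_def between_def by auto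
    then show ?thesis using PiE_\<phi> that by (simp add: colorings_def)
  qed
  have Q_to_P: "\<phi> \<kappa> \<in> colorings n P" if "\<kappa> \<in> colorings n Q" for \<kappa>
  proof -
    have \<kappa>: "\<kappa> v < \<kappa> j" "\<kappa> j < \<kappa> w" "\<And>a b. (a, b) \<in> S \<Longrightarrow> \<kappa> a < \<kappa> b"
      using that strict_Q by (auto simp: colorings_def)
    have "\<phi> \<kappa> a < \<phi> \<kappa> b" if "strict_edge n P a b" for a b
      using that \<kappa> S[of a b] \<tau> unfolding strict_P \<phi>_def between_def by auto
    then show ?thesis using PiE_\<phi> that by (simp add: colorings_def)
  qed
  have monomial_\<phi>: "color_monomial n (\<phi> \<kappa>) = color_monomial n \<kappa>" for \<kappa>
    using color_monomial_transpose[OF ij] by (simp add: \<phi>_def \<tau>_def)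
  show "G n P m = G n Q m"
    unfolding G_def
  proof (rule sum.reindex_bij_witness[where i = \<phi> and j = \<phi>])
    fix \<kappa> assume "\<kappa> \<in> {\<kappa> \<in> colorings n P. color_monomial n \<kappa> = m}"
    then have "\<kappa> v < \<kappa> i" "\<kappa> i < \<kappa> w"
      using strict_P by (auto simp: colorings_def)
    then show "monom 1 (asc n Q (\<phi> \<kappa>)) = (monom 1 (asc n P \<kappa>) :: int poly)"
      by (simp add: asc_\<phi>)
  qed (auto simp: \<phi>\<phi> P_to_Q Q_to_P monomial_\<phi>)
qed


section \<open>Lattice points and diagonal steps\<close>

lemma endpoint_Nil [simp]: "endpoint [] = 0"
  by (simp add: endpoint_def)

lemma endpoint_Cons [simp]: "endpoint (s # A) = step_vec s + endpoint A"
  by (simp add: endpoint_def)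

lemma step_vec_nonneg: "0 \<le> fst (step_vec s)" "0 \<le> snd (step_vec s)"
  by (cases s; simp)+

lemma endpoint_nonneg: "0 \<le> fst (endpoint A)" "0 \<le> snd (endpoint A)"
  by (induction A) (auto intro: add_nonneg_nonneg step_vec_nonneg)

text \<open>One of the two prefixes extends the other, and a nonempty word has nonzero displacement
  because no step goes back. Hence a lattice point determines its position in the word.\<close>

lemma prefix_eq_of_endpoint_eq:
  assumes "A @ B = A' @ B'" "endpoint A = endpoint A'"
  shows "A = A'"
proof -
  have nil: "C = []" if "endpoint C = 0" for C
  proof (cases C)
    case (Cons s D)
    then show ?thesis
      using that endpoint_nonneg[of D] by (cases s; cases "endpoint D") (auto simp: zero_prod_def)
  qed simp
  show ?thesis
    using assms(1) unfolding append_eq_append_conv2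
  proof (elim exE disjE conjE)
    fix C assume "A @ C = A'"
    then show ?thesis using assms(2) nil[of C] by (auto simp: endpoint_append)
  next
    fix C assume "A = A' @ C"
    then show ?thesis using assms(2) nil[of C] by (auto simp: endpoint_append)
  qed
qed

lemma lattice_points_Nil [simp]: "lattice_points [] = {0}"
  by (simp add: lattice_points_def)

lemma zero_in_lattice_points: "0 \<in> lattice_points A"
  by (simp add: lattice_points_def) (metis append_Nil endpoint_Nil)

lemma lattice_points_Cons:
  "lattice_points (s # B) = insert 0 ((+) (step_vec s) ` lattice_points B)"
proof (intro set_eqI iffI)
  fix p assume "p \<in> lattice_points (s # B)"
  then obtain C D where "s # B = C @ D" "p = endpoint C"
    by (auto simp: lattice_points_def)
  then show "p \<in> insert 0 ((+) (step_vec s) ` lattice_points B)"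
    by (cases C) (auto simp: lattice_points_def)
next
  fix p assume "p \<in> insert 0 ((+) (step_vec s) ` lattice_points B)"
  then consider "p = 0" | C D where "B = C @ D" "p = endpoint (s # C)"
    by (auto simp: lattice_points_def)
  then show "p \<in> lattice_points (s # B)"
  proof cases
    case 2
    then have "s # B = (s # C) @ D" by simp
    with 2 show ?thesis unfolding lattice_points_def by blast
  qed (simp add: zero_in_lattice_points)
qed

lemma lattice_points_append:
  "lattice_points (A @ B) = lattice_points A \<union> (+) (endpoint A) ` lattice_points B"
proof (induction A)
  case Nil
  then show ?case using zero_in_lattice_points[of B] by auto
next
  case (Cons s A)
  then show ?case by (simp add: lattice_points_Cons image_Un image_image add.assoc)
qed

lemma endpoint_in_lattice_points: "endpoint A \<in> lattice_points A"
  by (auto simp: lattice_points_def)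

lemma lattice_points_bounds:
  assumes "p \<in> lattice_points A"
  shows "0 \<le> fst p" "0 \<le> snd p" "fst p \<le> fst (endpoint A)" "snd p \<le> snd (endpoint A)"
  using assms by (auto simp: lattice_points_def endpoint_append endpoint_nonneg)

text \<open>A diagonal step is determined by its starting point, so this set carries all the
  information about strict edges. Like \<open>lattice_points\<close>, it is computed by recursion on
  the word.\<close>

definition diag_starts :: "step list \<Rightarrow> (int \<times> int) set" where
  "diag_starts P = {endpoint A | A B. P = A @ Diag # B}"

lemma diag_starts_Nil [simp]: "diag_starts [] = {}"
  by (simp add: diag_starts_def)

lemma diag_starts_Cons:
  "diag_starts (s # B) = (if s = Diag then {0} else {}) \<union> (+) (step_vec s) ` diag_starts B"
proof (intro set_eqI iffI)
  fix p assume "p \<in> diag_starts (s # B)"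
  then obtain C D where "s # B = C @ Diag # D" "p = endpoint C"
    by (auto simp: diag_starts_def)
  then show "p \<in> (if s = Diag then {0} else {}) \<union> (+) (step_vec s) ` diag_starts B"
    by (cases C) (auto simp: diag_starts_def)
next
  fix p assume "p \<in> (if s = Diag then {0} else {}) \<union> (+) (step_vec s) ` diag_starts B"
  then consider "s = Diag" "p = endpoint []" | C D where "B = C @ Diag # D" "p = endpoint (s # C)"
    by (auto simp: diag_starts_def split: if_splits)
  then show "p \<in> diag_starts (s # B)"
  proof cases
    case 1
    then have "s # B = [] @ Diag # B" by simp
    with 1 show ?thesis unfolding diag_starts_def by blast
  next
    case 2
    then have "s # B = (s # C) @ Diag # D" by simp
    with 2 show ?thesis unfolding diag_starts_def by blast
  qed
qed

lemma diag_starts_append: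
  "diag_starts (A @ B) = diag_starts A \<union> (+) (endpoint A) ` diag_starts B"
  by (induction A) (simp_all add: diag_starts_Cons image_Un image_image add.assoc Un_assoc)

text \<open>The upper bounds are strict, unlike those for lattice points, since the diagonal step
  itself still has to fit. This later keeps the common diagonals away from x - 1.\<close>

lemma diag_starts_bounds:
  assumes "p \<in> diag_starts A"
  shows "0 \<le> fst p" "0 \<le> snd p" "fst p < fst (endpoint A)" "snd p < snd (endpoint A)"
proof -
  obtain C D where "A = C @ Diag # D" "p = endpoint C"
    using assms by (auto simp: diag_starts_def)
  then show "0 \<le> fst p" "0 \<le> snd p" "fst p < fst (endpoint A)" "snd p < snd (endpoint A)"
    using endpoint_nonneg[of C] endpoint_nonneg[of D] by (auto simp: endpoint_append)
qed


section \<open>Edges in terms of lattice points\<close>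

lemma strict_edge_iff:
  "strict_edge n P a b \<longleftrightarrow>
     1 \<le> a \<and> a < b \<and> b \<le> n \<and> (int a - 1, int b - 1) \<in> diag_starts P"
proof -
  have "endpoint A = (int a - 1, int b - 1) \<and> endpoint (A @ [Diag]) = (int a, int b) \<longleftrightarrow>
      (int a - 1, int b - 1) = endpoint A" for A
    by (cases "endpoint A") (auto simp: endpoint_append)
  then show ?thesis
    unfolding strict_edge_def diag_starts_def mem_Collect_eq by (simp only:) blast
qed

text \<open>A step advances horizontally by 0 or 1, so a curve point with integer abscissa lies on a
  north step or is an end of another step.\<close>

lemma path_curve_integer_abscissa:
  assumes "(real_of_int k, t) \<in> path_curve P"
  obtains h where "(k, h) \<in> lattice_points P" "t \<le> real_of_int h"
proof -
  obtain A s B where P: "P = A @ s # B"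
    and seg: "(real_of_int k, t) \<in>
      closed_segment (real_point (endpoint A)) (real_point (endpoint (A @ [s])))"
    using assms by (auto simp: path_curve_def)
  obtain c d where A: "endpoint A = (c, d)" by fastforce
  obtain u :: real where u: "0 \<le> u" "u \<le> 1"
    and k: "real_of_int k = real_of_int c + u * real_of_int (fst (step_vec s))"
    and t: "t = real_of_int d + u * real_of_int (snd (step_vec s))"
    using seg by (auto simp: in_segment real_point_def endpoint_append A algebra_simps)
  have mem: "endpoint A \<in> lattice_points P" "endpoint (A @ [s]) \<in> lattice_points P"
    using zero_in_lattice_points
    by (auto simp: P lattice_points_append lattice_points_Cons endpoint_append endpoint_in_lattice_points)
  show thesis
  proof (cases "s = North")
    case True
    then show thesis
      \<comment> \<open>The witness is the top of the north step.\<close>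
      using that[of "d + 1"] mem u k t by (auto simp: A endpoint_append)
  next
    case False
    then have u_eq: "u = real_of_int (k - c)"
      using k by (cases s) auto
    then have "0 \<le> k - c" "k - c \<le> 1"
      using u by simp_all
    then consider "u = 0" "k = c" | "u = 1" "k = c + 1"
      using u_eq by (cases "k = c") auto
    then show thesis
    proof cases
      case 1
      then show thesis using that[of d] mem t by (simp add: A)
    next
      case 2
      then show thesis
        using that[of "d + snd (step_vec s)"] mem t False
        by (cases s) (auto simp: A endpoint_append)
    qed
  qed
qed

text \<open>The path ends to the right of abscissa \<open>k\<close>, so after reaching (k, h) it
  must cross the whole column by an east or diagonal step, at height at least
  \<open>h\<close>.\<close>

lemma column_below_path_curve:
  assumes "(k, h) \<in> lattice_points P" "k < fst (endpoint P)"
    and r: "real_of_int k \<le> r" "r \<le> real_of_int k + 1"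
  obtains t where "(r, t) \<in> path_curve P" "real_of_int h \<le> t"
proof -
  obtain A B where P: "P = A @ B" and A: "endpoint A = (k, h)"
    using assms(1) by (auto simp: lattice_points_def)
  have "\<exists>s\<in>set B. s \<noteq> North"
  proof (rule ccontr)
    assume "\<not> ?thesis"
    then have "fst (endpoint B) = 0" by (induction B) auto
    then show False using assms(2) by (simp add: P A endpoint_append)
  qed
  then obtain C s D where B: "B = C @ s # D" and s: "s \<noteq> North" and C: "\<forall>c\<in>set C. c = North"
    using split_list_first_prop[of B "\<lambda>s. s \<noteq> North"] by blast
  have "fst (endpoint C) = 0" using C by (induction C) auto
  then obtain h' where AC: "endpoint (A @ C) = (k, h')" and h': "h \<le> h'"
    using endpoint_nonneg[of C] by (cases "endpoint C") (auto simp: endpoint_append A)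
  \<comment> \<open>The height at abscissa \<open>r\<close> of the first step after (k, h) that is
    not north, by linear interpolation.\<close>
  define t where "t = real_of_int h' + (r - real_of_int k) * real_of_int (snd (step_vec s))"
  have "(r, t) \<in> closed_segment (real_point (endpoint (A @ C))) (real_point (endpoint ((A @ C) @ [s])))"
    unfolding in_segment endpoint_append[of "A @ C" "[s]"] AC t_def
    using r s by (intro exI[of _ "r - real_of_int k"], cases s) (auto simp: real_point_def algebra_simps)
  then have "(r, t) \<in> path_curve P"
    unfolding path_curve_def using P B by (intro UnionI CollectI exI[of _ "A @ C"] exI[of _ s] exI[of _ D]) auto
  moreover have "real_of_int h \<le> t"
    using h' r step_vec_nonneg(2)[of s] unfolding t_def
    by (smt (verit) mult_nonneg_nonneg of_int_0_le_iff of_int_le_iff)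
  ultimately show thesis by (rule that)
qed

text \<open>The upper left corner (a - 1, b) decides whether the square lies below the path, because
  the path never descends. The side y = x is no obstacle, as a \<le> b - 1.\<close>

lemma nonstrict_edge_iff:
  assumes "fst (endpoint P) = int n"
  shows "nonstrict_edge n P a b \<longleftrightarrow>
     1 \<le> a \<and> a < b \<and> b \<le> n \<and> (\<exists>h. int b \<le> h \<and> (int a - 1, h) \<in> lattice_points P)"
proof (cases "1 \<le> a \<and> a < b \<and> b \<le> n")
  case True
  have "{real a - 1 .. real a} \<times> {real b - 1 .. real b} \<subseteq> region P \<longleftrightarrow>
      (\<exists>h. int b \<le> h \<and> (int a - 1, h) \<in> lattice_points P)"
  proof
    assume "{real a - 1 .. real a} \<times> {real b - 1 .. real b} \<subseteq> region P"
    then have "(real a - 1, real b) \<in> region P" by auto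
    then obtain t where "t \<ge> real b" "(real_of_int (int a - 1), t) \<in> path_curve P"
      by (auto simp: region_def)
    then show "\<exists>h. int b \<le> h \<and> (int a - 1, h) \<in> lattice_points P"
      by (metis path_curve_integer_abscissa of_int_le_iff of_int_of_nat_eq order_trans)
  next
    assume "\<exists>h. int b \<le> h \<and> (int a - 1, h) \<in> lattice_points P"
    then obtain h where h: "int b \<le> h" "(int a - 1, h) \<in> lattice_points P" by blast
    show "{real a - 1 .. real a} \<times> {real b - 1 .. real b} \<subseteq> region P"
    proof clarify
      fix r t assume rt: "r \<in> {real a - 1 .. real a}" "t \<in> {real b - 1 .. real b}"
      obtain t' where "(r, t') \<in> path_curve P" "real_of_int h \<le> t'"
        using column_below_path_curve[OF h(2), of r] rt True assms by auto
      moreover have "real b \<le> real_of_int h" using h(1) by linarith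
      moreover have "real a \<le> real b - 1" using True by linarith
      ultimately show "(r, t) \<in> region P"
        using rt by (auto simp: region_def intro!: exI[of _ t'])
    qed
  qed
  then show ?thesis by (simp add: nonstrict_edge_def True)
qed (auto simp: nonstrict_edge_def)


section \<open>The bounce move\<close>

lemma first_west_unique: "first_west P u v \<Longrightarrow> first_west P u v' \<Longrightarrow> v = v'"
  unfolding first_west_def by (meson linorder_neqE)

text \<open>A point occurs at only one position of the word, which fixes its adjacent steps. The two
  rules of \<open>bounce_path\<close> therefore exclude each other.\<close>

lemma not_between_diagonals_if_incident:
  assumes "incident_north_or_east P p"
  shows "\<not> between_diagonals P p"
proof
  assume "between_diagonals P p"
  then obtain A B where P: "P = A @ [Diag, Diag] @ B" and p: "p = endpoint (A @ [Diag])"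
    by (auto simp: between_diagonals_def)
  obtain A' s B' where P': "P = A' @ s # B'" and s: "s \<in> {North, East}"
    and p': "p = endpoint A' \<or> p = endpoint (A' @ [s])"
    using assms by (auto simp: incident_north_or_east_def)
  from p' show False
  proof
    assume "p = endpoint A'"
    then have "A' = A @ [Diag]"
      using P P' p by (intro prefix_eq_of_endpoint_eq[of A' "s # B'" _ "Diag # B"]) auto
    then show False using P P' s by auto
  next
    assume "p = endpoint (A' @ [s])"
    then have "A' @ [s] = A @ [Diag]"
      using P P' p by (intro prefix_eq_of_endpoint_eq[of "A' @ [s]" B' _ "Diag # B"]) auto
    then show False using s by auto
  qed
qed

text \<open>The bounce decomposition brings its own list of bounce points; this identifies its
  stopping point with that of the given bounce path. A list of length 1 can only come from the rule
  \<open>stop\<close>, since the tail in \<open>bounce\<close> is nonempty.\<close>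

lemma bounce_path_stop_unique:
  assumes "bounce_path P r bs p" "length bs = 1" "bounce_path P r bs' p'"
  shows "p' = p" "snd p = fst r"
proof -
  have nonempty: "bs'' \<noteq> []" if "bounce_path P q bs'' q'" for q bs'' q'
    using that by cases auto
  from assms(1,2) obtain u1 u0 u2 where r: "r = (u1, u0)" and p: "p = (u2, u1)"
    and u2: "first_west P u1 u2" "incident_north_or_east P (u2, u1)"
    by cases (auto dest: nonempty)
  then show "snd p = fst r" by simp
  from assms(3) show "p' = p"
    using first_west_unique[OF u2(1)] not_between_diagonals_if_incident[OF u2(2)]
    by cases (auto simp: r p)
qed

text \<open>Diagonal steps cancel, so the count condition on Schroeder paths becomes one on
  coordinates.\<close>

lemma north_minus_east: "snd (endpoint A) - fst (endpoint A) =
    int (count_list A North) - int (count_list A East)"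
proof (induction A)
  case (Cons s A)
  then show ?case by (cases s) auto
qed simp

lemma G_bounce_move:
  assumes P: "schroeder_path n (U @ [Diag, North] @ V @ [Diag, East] @ W)" (is "schroeder_path n ?P")
    and stop: "snd (endpoint (U @ [Diag])) = x"
    and start: "endpoint (U @ [Diag, North] @ V @ [Diag]) = (x, z)"
    and xz: "z > x + 1"
  shows "G n ?P = G n (U @ [North, Diag] @ V @ [East, Diag] @ W)" (is "_ = G n ?Q")
proof -
  \<comment> \<open>The bounce path stops at (y, x). Both paths pass through (y - 1, x - 1), (y, x +
    1), (x - 1, z - 1) and (x + 1, z); between the first two and between the last two they use
    different intermediate points.\<close>
  obtain y where U: "endpoint U = (y - 1, x - 1)"
    using stop by (cases "endpoint U") (auto simp: endpoint_append intro: that[of "fst (endpoint U) + 1"])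
  have V: "endpoint V = (x - 1 - y, z - 1 - (x + 1))"
    using start U by (cases "endpoint V") (auto simp: endpoint_append)
  have end_P: "endpoint ?P = (int n, int n)"
    using P by (simp add: schroeder_path_def)
  have W: "endpoint W = (int n - (x + 1), int n - z)"
    using end_P U V by (cases "endpoint W") (auto simp: endpoint_append)
  have end_Q: "endpoint ?Q = (int n, int n)"
    using U V W by (simp add: endpoint_append)
  have fst_P: "fst (endpoint ?P) = int n" and fst_Q: "fst (endpoint ?Q) = int n"
    unfolding end_P end_Q by simp_all
  \<comment> \<open>The path condition at the diagonal step following \<open>U\<close>.\<close>
  have yx: "y < x"
  proof -
    have "count_list U North > count_list U East"
      using P by (auto simp: schroeder_path_def)
    then show ?thesis using north_minus_east[of U] by (simp add: U)
  qed
  have y1: "1 \<le> y" using endpoint_nonneg[of U] by (simp add: U)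
  have zn: "z \<le> int n" using endpoint_nonneg[of W] by (simp add: W)
  define i v w where "i = nat x" and "v = nat y" and "w = nat z"
  have xyz: "x = int i" "y = int v" "z = int w"
    using yx y1 xz by (auto simp: i_def v_def w_def)

  \<comment> \<open>The lattice points of \<open>U\<close>, \<open>V\<close> and \<open>W\<close> in
    their places, which are the same on both paths.\<close>
  define L where "L = lattice_points U \<union> (+) (y, x + 1) ` lattice_points V
    \<union> (+) (x + 1, z) ` lattice_points W"
  have shift: "(\<lambda>p. c + (d + p)) ` K = (+) (c + d) ` K" for c d :: "int \<times> int" and K
    by (simp add: add.assoc)
  have corners: "(y - 1, x - 1) \<in> lattice_points U"
    "(y, x + 1) \<in> (+) (y, x + 1) ` lattice_points V"
    "(x - 1, z - 1) \<in> (+) (y, x + 1) ` lattice_points V"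
    "(x + 1, z) \<in> (+) (x + 1, z) ` lattice_points W"
    using endpoint_in_lattice_points[of U] zero_in_lattice_points[of V]
      endpoint_in_lattice_points[of V] zero_in_lattice_points[of W]
    by (force simp: U V zero_prod_def)+
  have L_P: "lattice_points ?P = L \<union> {(y, x), (x, z)}"
    by (simp add: L_def lattice_points_append lattice_points_Cons U V image_image image_Un shift
        zero_prod_def add.commute[of 1 x]) (use corners in blast)
  have L_Q: "lattice_points ?Q = L \<union> {(y - 1, x), (x, z - 1)}"
    by (simp add: L_def lattice_points_append lattice_points_Cons U V image_image image_Un shift
        zero_prod_def add.commute[of 1 x]) (use corners in blast)
  \<comment> \<open>The points common to both paths avoid row \<open>x\<close> and column \<open>x\<close>, which makes \<open>x\<close> and \<open>x + 1\<close> twins.\<close>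
  have sectors: "fst p \<le> y - 1 \<and> snd p \<le> x - 1 \<or>
      y \<le> fst p \<and> x + 1 \<le> snd p \<and> fst p \<le> x - 1 \<and> snd p \<le> z - 1 \<or>
      x + 1 \<le> fst p \<and> z \<le> snd p" if "p \<in> L" for p
  proof -
    from that consider "p \<in> lattice_points U" | q where "p = (y, x + 1) + q" "q \<in> lattice_points V"
      | q where "p = (x + 1, z) + q" "q \<in> lattice_points W"
      unfolding L_def by blast
    then show ?thesis
    proof cases
      case 1
      show ?thesis using lattice_points_bounds[OF 1] yx xz by (simp add: U)
    next
      case 2
      show ?thesis using lattice_points_bounds[OF 2(2)] yx xz by (simp add: 2(1) V)
    next
      case 3
      show ?thesis using lattice_points_bounds[OF 3(2)] yx xz by (simp add: 3(1))
    qed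
  qed
  have corners_L: "(y - 1, x - 1) \<in> L" "(y, x + 1) \<in> L" "(x - 1, z - 1) \<in> L"
    using corners unfolding L_def by blast+
  \<comment> \<open>The criterion of \<open>nonstrict_edge_iff\<close> restricted to the common
    points; vertex \<open>a\<close> belongs to abscissa a - 1, the left side of its column.\<close>
  define above where "above a b \<longleftrightarrow> (\<exists>h. int b \<le> h \<and> (int a - 1, h) \<in> L)" for a b
  have above_i: "above i b \<longleftrightarrow> b < w" for b
  proof
    assume "above i b"
    then obtain h where "int b \<le> h" "(x - 1, h) \<in> L" by (auto simp: above_def xyz)
    then show "b < w" using sectors[of "(x - 1, h)"] yx by (auto simp: xyz)
  next
    assume "b < w"
    then show "above i b" using corners_L(3) by (auto simp: above_def xyz intro!: exI[of _ "z - 1"])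
  qed
  have above_Suc_i: "\<not> above (Suc i) b" for b
    using sectors[of "(x, _)"] yx by (auto simp: above_def xyz)
  \<comment> \<open>A common point at height at least x has height at least x + 1, since row x
    contains none.\<close>
  have above_row: "above a (Suc i)" if "above a i" "a < i" for a
  proof -
    from that obtain h where "int i \<le> h" "(int a - 1, h) \<in> L" by (auto simp: above_def)
    then show ?thesis
      using sectors[of "(int a - 1, h)"] that(2) by (auto simp: above_def xyz intro!: exI[of _ h])
  qed
  have above_mono: "above a b'" if "above a b" "b' \<le> b" for a b b'
    using that unfolding above_def by (meson of_nat_mono order_trans)
  have not_above_v: "\<not> above v i"
  proof
    assume "above v i"
    then obtain h where "x \<le> h" "(y - 1, h) \<in> L" by (auto simp: above_def xyz)
    then show False using sectors[of "(y - 1, h)"] yx by simp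
  qed
  have above_v: "above v b" if "b < i" for b
    using corners_L(1) that by (auto simp: above_def xyz intro!: exI[of _ "x - 1"])
  have above_Suc_v: "above (Suc v) b" if "b \<le> Suc i" for b
    using corners_L(2) that by (auto simp: above_def xyz intro!: exI[of _ "x + 1"])

  have vw: "1 \<le> v" "v < i" "Suc i < w" "w \<le> n"
    using y1 yx xz zn by (auto simp: xyz)
  \<comment> \<open>At abscissa x, where \<open>L\<close> has no point, one path has (x, z) and the
    other (x, z - 1). The edges from x + 1 to all b < z are thus common to both.\<close>
  define adj where "adj a b \<longleftrightarrow> above a b \<or> a = Suc i \<and> b < w" for a b
  have adj_i: "adj i (Suc i)"
    using above_i[of "Suc i"] vw(3) by (simp add: adj_def)
  have nonstrict_P: "nonstrict_edge n ?P a b \<longleftrightarrow>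
      1 \<le> a \<and> a < b \<and> b \<le> n \<and> (adj a b \<or> (a, b) = (Suc i, w))" for a b
  proof -
    have "(\<exists>h. int b \<le> h \<and> (int a - 1, h) \<in> lattice_points ?P) \<longleftrightarrow>
        above a b \<or> a = Suc v \<and> b \<le> i \<or> a = Suc i \<and> b \<le> w" if "1 \<le> a"
      using that unfolding L_P above_def by (auto simp: xyz conj_disj_distribL ex_disj_distrib)
    \<comment> \<open>The point (y, x) adds nothing because (y, x + 1) is common; (x, z) adds only
      the edge from x + 1 to z.\<close>
    moreover have "above a b \<or> a = Suc v \<and> b \<le> i \<or> a = Suc i \<and> b \<le> w \<longleftrightarrow>
        adj a b \<or> (a, b) = (Suc i, w)"
      using above_Suc_v[of b] by (auto simp: adj_def)
    ultimately show ?thesis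
      unfolding nonstrict_edge_iff[OF fst_P] by blast
  qed
  have nonstrict_Q: "nonstrict_edge n ?Q a b \<longleftrightarrow>
      1 \<le> a \<and> a < b \<and> b \<le> n \<and> (adj a b \<or> (a, b) = (v, i))" for a b
  proof -
    have "(\<exists>h. int b \<le> h \<and> (int a - 1, h) \<in> lattice_points ?Q) \<longleftrightarrow>
        above a b \<or> a = v \<and> b \<le> i \<or> a = Suc i \<and> b < w" if "1 \<le> a"
      using that unfolding L_Q above_def by (auto simp: xyz conj_disj_distribL ex_disj_distrib)
    \<comment> \<open>Since (y - 1, x - 1) is common, the point (y - 1, x) adds only the edge from y
      to x.\<close>
    moreover have "above a b \<or> a = v \<and> b \<le> i \<or> a = Suc i \<and> b < w \<longleftrightarrow>
        adj a b \<or> (a, b) = (v, i)"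
      if "a < b" using above_v[of b] that by (auto simp: adj_def)
    ultimately show ?thesis
      unfolding nonstrict_edge_iff[OF fst_Q] by blast
  qed
  define E where "E = {(a, b). (a, b) \<noteq> (i, Suc i) \<and> 1 \<le> a \<and> a < b \<and> b \<le> n \<and>
    adj a b}"
  define D where "D = diag_starts U \<union> (+) (y, x + 1) ` diag_starts V \<union> (+) (x + 1, z) ` diag_starts W"
  have D_P: "diag_starts ?P = D \<union> {(y - 1, x - 1), (x - 1, z - 1)}"
    by (simp add: D_def diag_starts_append diag_starts_Cons U V image_image image_Un shift
        zero_prod_def add.commute[of 1 x]) blast
  have D_Q: "diag_starts ?Q = D \<union> {(y - 1, x), (x, z - 1)}"
    by (simp add: D_def diag_starts_append diag_starts_Cons U V image_image image_Un shift
        zero_prod_def add.commute[of 1 x]) blast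
  have D_avoids: "fst p \<notin> {x - 1, x} \<and> snd p \<notin> {x - 1, x}" if "p \<in> D" for p
  proof -
    from that consider "p \<in> diag_starts U" | q where "p = (y, x + 1) + q" "q \<in> diag_starts V"
      | q where "p = (x + 1, z) + q" "q \<in> diag_starts W"
      unfolding D_def by blast
    then show ?thesis
    proof cases
      case 1
      show ?thesis using diag_starts_bounds[OF 1] yx xz by (simp add: U)
    next
      case 2
      show ?thesis using diag_starts_bounds[OF 2(2)] yx xz by (simp add: 2(1) V)
    next
      case 3
      show ?thesis using diag_starts_bounds[OF 3(2)] yx xz by (simp add: 3(1))
    qed
  qed
  define S where "S = {(a, b). 1 \<le> a \<and> a < b \<and> b \<le> n \<and> (int a - 1, int b - 1) \<in> D}"

  show ?thesis
  proof (rule G_eq_of_swapped_vertices[where E = E and S = S and i = i and j = "Suc i"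
        and v = v and w = w])
    fix a b
    show "nonstrict_edge n ?P a b \<longleftrightarrow> (a, b) \<in> E \<or> (a, b) = (i, Suc i) \<or> (a, b) = (Suc i, w)"
      unfolding nonstrict_P E_def using adj_i vw by auto
    show "nonstrict_edge n ?Q a b \<longleftrightarrow> (a, b) \<in> E \<or> (a, b) = (i, Suc i) \<or> (a, b) = (v, i)"
      unfolding nonstrict_Q E_def using adj_i vw by auto
    show "strict_edge n ?P a b \<longleftrightarrow> (a, b) \<in> S \<or> (a, b) = (v, i) \<or> (a, b) = (i, w)"
      using vw unfolding strict_edge_iff D_P S_def by (auto simp: xyz)
    show "strict_edge n ?Q a b \<longleftrightarrow> (a, b) \<in> S \<or> (a, b) = (v, Suc i) \<or> (a, b) = (Suc i, w)"
      using vw unfolding strict_edge_iff D_Q S_def by (auto simp: xyz)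
    show "a \<notin> {i, Suc i} \<and> b \<notin> {i, Suc i}" if "(a, b) \<in> S"
      using D_avoids[of "(int a - 1, int b - 1)"] that by (auto simp: S_def xyz)
    show "(Transposition.transpose i (Suc i) a, Transposition.transpose i (Suc i) b) \<in> E" if "(a, b) \<in> E"
    proof -
      have ab: "(a, b) \<noteq> (i, Suc i)" "1 \<le> a" "a < b" "b \<le> n" "above a b \<or> a = Suc i \<and> b < w"
        using that by (auto simp: E_def adj_def)
      \<comment> \<open>As lower endpoints, x and x + 1 both reach exactly the b < z beyond x + 1.
        As upper endpoints, they are exchanged by \<open>above_row\<close> in one direction and
        \<open>above_mono\<close> in the other.\<close>
      have "a = i \<and> Suc i < b \<or> a = Suc i \<and> Suc i < b \<or> b = i \<and> a < i \<or> b = Suc i \<and> a < i \<or>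
          a \<noteq> i \<and> a \<noteq> Suc i \<and> b \<noteq> i \<and> b \<noteq> Suc i"
        using ab(1,3) unfolding prod.inject by presburger
      then consider "a = i" "Suc i < b" | "a = Suc i" "Suc i < b" | "b = i" "a < i"
        | "b = Suc i" "a < i" | "a \<noteq> i" "a \<noteq> Suc i" "b \<noteq> i" "b \<noteq> Suc i"
        by blast
      then show ?thesis
      proof cases
        case 3
        then show ?thesis using ab vw above_row[of a] by (auto simp: E_def adj_def)
      next
        case 4
        then show ?thesis using ab above_mono[of a b i] by (auto simp: E_def adj_def)
      qed (use ab vw above_i above_Suc_i in \<open>auto simp: E_def adj_def transpose_apply_other\<close>)
    qed
  qed (use vw above_Suc_i not_above_v in \<open>auto simp: E_def adj_def\<close>)
qed

theorem theorem4p5: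
  fixes n :: nat and P U V W :: "step list" and x z :: int
    and bs :: "(int \<times> int) list" and p :: "int \<times> int"
  assumes "schroeder_path n P"
    and "(x, z) \<in> lattice_points P"
    and "z > x + 1"
    and "bounce_path P (x, z) bs p" and "length bs = 1"
    and "bounce_decomposition P (x, z) U Diag North V Diag East W"
  shows "G n P = G n (U @ [North, Diag] @ V @ [East, Diag] @ W)"
proof -
  obtain bs' where bs': "bounce_path P (x, z) bs' (endpoint (U @ [Diag]))"
    and P: "P = U @ [Diag, North] @ V @ [Diag, East] @ W"
    and start: "endpoint (U @ [Diag, North] @ V @ [Diag]) = (x, z)"
    using assms(6) by (auto simp: bounce_decomposition_def)
  have "snd (endpoint (U @ [Diag])) = x"
    using bounce_path_stop_unique[OF assms(4,5) bs'] by simp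
  then show ?thesis
    using G_bounce_move[OF _ _ start assms(3)] assms(1) P by simp
qed

end
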